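(* For every integer $n\ge 1$ one has $a(n)\le 3$. That is, for $n$ coins weighing $1,2,\ldots,n$ grams, there is always a sequence of at most three weighings on a balance scale that determines the weight of at least one of the coins.
   Context: There are $n$ coins weighing $1,2,\ldots,n$ grams (one of each weight). Identify each coin with its true weight, so the coins are the elements of $\{1,\ldots,n\}$. Baron M\"unchhausen knows all the weights; the audience knows only that the weights are $1,\ldots,n$ in some order. A weighing on a balance scale is an ordered pair $(L,R)$ of disjoint nonempty subsets of $\{1,\ldots,n\}$ (the coins in the left and right cups); its outcome is whether $\sum_{x\in L}x$ is less than, equal to, or greater than $\sum_{x\in R}x$. The audience can tell the coins apart and track them across weighings, and sees the outcomes. A sequence of weighings $(L_1,R_1),\ldots,(L_m,R_m)$ determines (demonstrates) the weight of coin $k$ if every permutation $\sigma$ of $\{1,\ldots,n\}$ that is consistent with all the outcomes (i.e. for each $r$, $\sum_{x\in L_r}\sigma(x)-\sum_{x\in R_r}\sigma(x)$ has the same sign, negative, zero or positive, as $\sum_{x\in L_r}x-\sum_{x\in R_r}x$) satisfies $\sigma(k)=k$. Baron M\"unchhausen's sequence $a(n)$ is the minimum number $m\ge 0$ of weighings in a sequence that determines the weight of at least one coin. *)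

theory Defs
  imports Main "HOL-Combinatorics.Permutations"
begin

text \<open>A coin is identified with its true weight, so the coins are the elements of
  \<open>{1..n}\<close>, and a weighing is the pair of the contents of the left and the right cup.\<close>

type_synonym weighing = "nat set \<times> nat set"

definition is_weighing :: "nat \<Rightarrow> weighing \<Rightarrow> bool" where
  "is_weighing n W \<longleftrightarrow>
     fst W \<subseteq> {1..n} \<and> snd W \<subseteq> {1..n} \<and> fst W \<noteq> {} \<and> snd W \<noteq> {} \<and> fst W \<inter> snd W = {}"

text \<open>The outcome when coin \<open>x\<close> weighs \<open>w x\<close> grams: \<open>-1\<close>, \<open>0\<close> or \<open>1\<close> according to whether
  the left cup is lighter than, as heavy as, or heavier than the right one.\<close>

definition outcome :: "(nat \<Rightarrow> nat) \<Rightarrow> weighing \<Rightarrow> int" where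
  "outcome w W = sgn ((\<Sum>x\<in>fst W. int (w x)) - (\<Sum>x\<in>snd W. int (w x)))"

text \<open>The true assignment of weights is \<open>id\<close>.\<close>

definition consistent :: "weighing list \<Rightarrow> (nat \<Rightarrow> nat) \<Rightarrow> bool" where
  "consistent Ws \<sigma> \<longleftrightarrow> (\<forall>W\<in>set Ws. outcome \<sigma> W = outcome id W)"

definition determines :: "nat \<Rightarrow> weighing list \<Rightarrow> nat \<Rightarrow> bool" where
  "determines n Ws k \<longleftrightarrow> (\<forall>\<sigma>. \<sigma> permutes {1..n} \<and> consistent Ws \<sigma> \<longrightarrow> \<sigma> k = k)"

definition demonstrates_some_coin :: "nat \<Rightarrow> weighing list \<Rightarrow> bool" where
  "demonstrates_some_coin n Ws \<longleftrightarrow>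
     (\<forall>W\<in>set Ws. is_weighing n W) \<and> (\<exists>k\<in>{1..n}. determines n Ws k)"

text \<open>Baron Munchhausen's sequence. \<open>LEAST\<close> is meaningful only if some sequence of
  weighings determines a coin.\<close>

definition baron :: "nat \<Rightarrow> nat" where
  "baron n = (LEAST m. \<exists>Ws. length Ws = m \<and> demonstrates_some_coin n Ws)"

end

theory Submission
  imports Defs
begin

text \<open>
  Let \<open>S b\<close> denote the total weight that a permutation \<open>\<sigma>\<close> gives to the coins \<open>1, \<dots>, b\<close>. Since
  \<open>\<sigma>\<close> takes distinct positive values, \<open>S b\<close> is at least the triangular number
  \<open>T b = 1 + \<dots> + b\<close>. So if the outcomes force some sum of terms \<open>S b\<close> down to the corresponding
  sum of triangular numbers, every term is tight; and if \<open>S (h - 1)\<close> and \<open>S h\<close> are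
  both tight, then \<open>\<sigma> h = h\<close>.

  Two balanced weighings achieve this for almost all \<open>n\<close>, thanks to the identities
  \<open>T (2k) = 3 T k + T (k - 1)\<close> and \<open>T (2k + 1) = 3 T k + T (k + 1)\<close>. Both are of the form
  \<open>T n = T a + T h + 2 T k\<close> with \<open>a = h - 1\<close> and \<open>n = h + k\<close>, where \<open>h = k\<close> for even \<open>n\<close> and
  \<open>h = k + 1\<close> for odd \<open>n\<close>. Split the coins heavier than \<open>h\<close> into a part \<open>Y\<close> of total weight
  \<open>T k\<close> and the rest \<open>X\<close>. Then \<open>{1..k}\<close> balances \<open>Y\<close>, and \<open>{1..a} \<union> Y\<close> balances \<open>X\<close>. For a
  consistent \<open>\<sigma>\<close> these two balances turn the total weight \<open>T n = S h + \<sigma>(X) + \<sigma>(Y)\<close> into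
  \<open>S h + S a + 2 S k\<close>, so that coin \<open>h\<close> is determined (lemma \<open>split_determines_coin\<close>).

  A suitable \<open>Y\<close> exists because the sums of \<open>j\<close> distinct elements of an interval fill an
  interval (lemma \<open>subset_sum_interval\<close>), and \<open>j\<close> about \<open>k/3\<close> puts \<open>T k\<close> into it
  (lemma \<open>heavy_half_splits\<close>). The sizes \<open>n = 2, 3, 5, 8, 9\<close>, for which there is no such \<open>Y\<close>, are
  settled by weighing small coins against a single one, which bounds the weight
  of coin \<open>n\<close> from below by \<open>n\<close>. Hence two weighings always suffice.
\<close>

section \<open>Triangular numbers and initial segments\<close>

lemma twice_triangular: "2 * \<Sum>{1..k::nat} = k * (k + 1)"
  by (induction k) (auto simp: algebra_simps)

lemma sum_distinct_positive_ge:
  fixes A :: "nat set"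
  assumes "finite A" "0 \<notin> A"
  shows "\<Sum>{1..card A} \<le> \<Sum>A"
  using assms
proof (induction "card A" arbitrary: A)
  case 0
  then show ?case by simp
next
  case (Suc c)
  let ?m = "Max A"
  have "A \<noteq> {}" using Suc.hyps(2) by auto
  then have m: "?m \<in> A" using Suc.prems by simp
  have "A \<subseteq> {1..?m}"
    using Suc.prems by (auto simp: Suc_le_eq intro: gr0I)
  then have "card A \<le> ?m"
    using card_mono[of "{1..?m}" A] by simp
  moreover have "c = card (A - {?m})" using Suc.hyps(2) Suc.prems m by simp
  then have "\<Sum>{1..c} \<le> \<Sum>(A - {?m})"
    using Suc.hyps(1)[of "A - {?m}"] Suc.prems by simp
  moreover have "\<Sum>A = ?m + \<Sum>(A - {?m})"
    using sum.remove[OF Suc.prems(1) m, of "\<lambda>x. x"] by simp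
  ultimately show ?case using Suc.hyps(2)[symmetric] by simp
qed

lemma initial_segment_weight_ge:
  fixes \<sigma> :: "nat \<Rightarrow> nat"
  assumes "\<sigma> permutes {1..n}" "b \<le> n"
  shows "\<Sum>{1..b} \<le> sum \<sigma> {1..b}"
proof -
  have inj: "inj_on \<sigma> {1..b}"
    using permutes_inj[OF assms(1)] by (simp add: inj_on_def)
  have "\<sigma> i \<in> {1..n}" if "i \<in> {1..b}" for i
    using permutes_in_image[OF assms(1), of i] that assms(2) by auto
  then have "\<sigma> ` {1..b} \<subseteq> {1..n}" by blast
  then have "0 \<notin> \<sigma> ` {1..b}" by auto
  then have "\<Sum>{1..card (\<sigma> ` {1..b})} \<le> \<Sum>(\<sigma> ` {1..b})"
    by (intro sum_distinct_positive_ge) auto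
  then show ?thesis
    using inj by (simp add: card_image sum.reindex)
qed

lemma permuted_total_weight:
  fixes \<sigma> :: "nat \<Rightarrow> nat"
  assumes "\<sigma> permutes {1..n}"
  shows "sum \<sigma> {1..n} = \<Sum>{1..n}"
  using sum.permute[OF assms, of "\<lambda>x. x"] by simp

section \<open>Reading outcomes\<close>

lemma outcome_eq_0_iff: "outcome w (L, R) = 0 \<longleftrightarrow> sum w L = sum w R"
  by (simp add: outcome_def sgn_if flip: of_nat_sum)

lemma outcome_eq_minus_1_iff: "outcome w (L, R) = -1 \<longleftrightarrow> sum w L < sum w R"
  by (simp add: outcome_def sgn_if flip: of_nat_sum)

lemma balance_preserved:
  assumes "outcome \<sigma> (L, R) = outcome id (L, R)" "\<Sum>L = \<Sum>R"
  shows "sum \<sigma> L = sum \<sigma> R"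
proof -
  have "outcome id (L, R) = 0" using assms(2) by (simp add: outcome_eq_0_iff)
  then show ?thesis using assms(1) outcome_eq_0_iff[of \<sigma> L R] by simp
qed

text \<open>A single coin that is equal to, or one gram heavier than, the opposite cup \<open>L\<close> inherits a
  sharp lower bound from \<open>L\<close>: as weights are integral, the outcome ``lighter'' is as
  informative as a gap of exactly one.\<close>

lemma single_coin_ge:
  assumes out: "outcome \<sigma> (L, {m}) = outcome id (L, {m})"
    and m: "\<Sum>L \<le> m" "m \<le> \<Sum>L + 1"
    and L: "\<Sum>L \<le> sum \<sigma> L"
  shows "m \<le> \<sigma> m"
proof (cases "m = \<Sum>L")
  case True
  then show ?thesis using balance_preserved[OF out] L by simp
next
  case False
  then have "outcome id (L, {m}) = -1" using m by (simp add: outcome_eq_minus_1_iff)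
  then have "sum \<sigma> L < \<sigma> m" using out outcome_eq_minus_1_iff[of \<sigma> L "{m}"] by simp
  then show ?thesis using m L by simp
qed

lemma heaviest_coin_determined:
  assumes "n \<ge> 1"
    and "\<And>\<sigma>. \<sigma> permutes {1..n} \<Longrightarrow> consistent Ws \<sigma> \<Longrightarrow> n \<le> \<sigma> n"
  shows "determines n Ws n"
  unfolding determines_def
proof (intro allI impI)
  fix \<sigma> assume \<sigma>: "\<sigma> permutes {1..n} \<and> consistent Ws \<sigma>"
  then have "\<sigma> n \<le> n" using permutes_in_image[of \<sigma> "{1..n}" n] assms(1) by simp
  then show "\<sigma> n = n" using assms(2) \<sigma> by (simp add: le_antisym)
qed

section \<open>Small numbers of coins\<close>

text \<open>The first weighing shows that coin \<open>x\<close> weighs at least \<open>x\<close>, which the second uses to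
  show that coin \<open>n\<close> weighs at least \<open>n\<close>. Either weighing may be a balance or an
  imbalance by one gram.\<close>

lemma two_step_chain:
  assumes a: "1 \<le> a" "a < x" and x: "\<Sum>{1..a} \<le> x" "x \<le> \<Sum>{1..a} + 1"
    and b: "b < x" and n: "x < n" "x + \<Sum>{1..b} \<le> n" "n \<le> x + \<Sum>{1..b} + 1"
  shows "demonstrates_some_coin n [({1..a}, {x}), (insert x {1..b}, {n})]" 
    (is "demonstrates_some_coin n ?Ws")
proof -
  have "determines n ?Ws n"
  proof (rule heaviest_coin_determined)
    fix \<sigma> assume \<sigma>: "\<sigma> permutes {1..n}" and "consistent ?Ws \<sigma>"
    then have out: "outcome \<sigma> ({1..a}, {x}) = outcome id ({1..a}, {x})"
      "outcome \<sigma> (insert x {1..b}, {n}) = outcome id (insert x {1..b}, {n})"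
      by (auto simp: consistent_def)
    have "x \<le> \<sigma> x"
      using single_coin_ge[OF out(1) x] initial_segment_weight_ge[OF \<sigma>, of a] a n by simp
    then have "\<Sum>(insert x {1..b}) \<le> sum \<sigma> (insert x {1..b})"
      using initial_segment_weight_ge[OF \<sigma>, of b] b n by simp
    then show "n \<le> \<sigma> n" using single_coin_ge[OF out(2)] b n by simp
  qed (use a n in simp)
  then show ?thesis
    using a b n by (auto simp: demonstrates_some_coin_def is_weighing_def)
qed

lemma few_coins:
  assumes "n \<in> {1, 2, 3, 5, 8, 9}"
  shows "\<exists>Ws. length Ws \<le> 2 \<and> demonstrates_some_coin n Ws"
proof -
  consider "n = 1" | "n = 2" | "n = 3" | "n = 5" | "n = 8" | "n = 9"
    using assms by auto
  then show ?thesis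
  proof cases
    case 1
    have "demonstrates_some_coin 1 []"
      by (auto simp: demonstrates_some_coin_def determines_def)
    then show ?thesis using 1 by (intro exI[of _ "[]"]) simp
  next
    case 2
    have "determines 2 [({1}, {2})] 2"
    proof (rule heaviest_coin_determined)
      fix \<sigma> assume \<sigma>: "\<sigma> permutes {1..2::nat}" and "consistent [({1}, {2})] \<sigma>"
      then have "outcome \<sigma> ({1}, {2}) = outcome id ({1}, {2})"
        by (simp add: consistent_def)
      then show "2 \<le> \<sigma> 2"
        using single_coin_ge[of \<sigma> "{1}" 2] initial_segment_weight_ge[OF \<sigma>, of 1] by simp
    qed simp
    then have "demonstrates_some_coin 2 [({1}, {2})]"
      by (auto simp: demonstrates_some_coin_def is_weighing_def)
    then show ?thesis using 2 by (intro exI[of _ "[({1}, {2})]"]) simp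
  next
    case 3
    show ?thesis using two_step_chain[of 1 2 1 n] 3
      by (intro exI[of _ "[({1..1}, {2}), (insert 2 {1..1}, {n})]"]) simp
  next
    case 4
    show ?thesis using two_step_chain[of 2 3 1 n] 4
      by (intro exI[of _ "[({1..2}, {3}), (insert 3 {1..1}, {n})]"]) (simp add: Sum_Icc_nat)
  next
    case 5
    show ?thesis using two_step_chain[of 3 6 1 n] 5
      by (intro exI[of _ "[({1..3}, {6}), (insert 6 {1..1}, {n})]"]) (simp add: Sum_Icc_nat)
  next
    case 6
    show ?thesis using two_step_chain[of 3 6 2 n] 6
      by (intro exI[of _ "[({1..3}, {6}), (insert 6 {1..2}, {n})]"]) (simp add: Sum_Icc_nat)
  qed
qed

section \<open>Splitting the heavy coins\<close>

text \<open>Every total between the extremes \<open>(s + 1) + \<dots> + (s + j)\<close> and \<open>(u + 1) + \<dots> + (u + j)\<close> is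
  attained by \<open>j\<close> consecutive numbers with at most one gap: increase the \<open>g\<close> largest
  elements of \<open>{x + 1..x + j}\<close> by one, where \<open>x\<close> and \<open>g\<close> are quotient and remainder of the
  excess over \<open>1 + \<dots> + j\<close> modulo \<open>j\<close>.\<close>

lemma subset_sum_interval:
  fixes j s t u :: nat
  assumes "1 \<le> j" "j * s + \<Sum>{1..j} \<le> t" "t \<le> j * u + \<Sum>{1..j}"
  shows "\<exists>Y \<subseteq> {s + 1..u + j}. \<Sum>Y = t"
proof -
  define x where "x = (t - \<Sum>{1..j}) div j"
  define g where "g = (t - \<Sum>{1..j}) mod j"
  define f where "f i = x + i + (if j - g < i then 1 else 0)" for i
  have t: "t = j * x + g + \<Sum>{1..j}"
    using assms(2) by (simp add: x_def g_def)
  have g: "g < j" using assms(1) by (simp add: g_def)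
  have "j * s < j * (x + 1)" using t g assms(2) by simp
  then have "s < x + 1" by (metis mult_less_cancel1)
  then have "s \<le> x" by simp
  have xu: "j * x + g \<le> j * u" using t assms(3) by simp
  have upper: "x < u \<or> x \<le> u \<and> g = 0"
  proof (cases "g = 0")
    case True
    then show ?thesis using xu assms(1) by simp
  next
    case False
    then have "j * x < j * u" using xu by linarith
    then show ?thesis by simp
  qed
  have inj: "inj_on f {1..j}"
    by (rule strict_mono_on_imp_inj_on) (auto simp: strict_mono_on_def f_def)
  have "f ` {1..j} \<subseteq> {s + 1..u + j}"
    using \<open>s \<le> x\<close> upper by (auto simp: f_def)
  moreover have "\<Sum>(f ` {1..j}) = t"
  proof -
    have "\<Sum>(f ` {1..j}) = (\<Sum>i=1..j. x + i + (if j - g < i then 1 else 0))"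
      using sum.reindex[OF inj, of "\<lambda>y. y"] by (simp add: f_def)
    also have "\<dots> = j * x + \<Sum>{1..j} + card ({1..j} \<inter> {i. j - g < i})"
      by (simp add: sum.distrib sum.If_cases)
    also have "{1..j} \<inter> {i. j - g < i} = {j - g + 1..j}" by auto
    finally show ?thesis using t g by simp
  qed
  ultimately show ?thesis by blast
qed

text \<open>With \<open>k = 3j + r\<close> and \<open>\<bar>r\<bar> \<le> 1\<close>, both inequalities required by the preceding lemma hold with
  a margin quadratic in \<open>j\<close>: for \<open>h\<close> close to \<open>k\<close> the possible sums of \<open>j\<close> elements range
  from about \<open>3.5 j\<^sup>2\<close> to \<open>5.5 j\<^sup>2\<close>, while the target is about \<open>4.5 j\<^sup>2\<close>. The margin
  absorbs the lower order terms if \<open>j \<ge> 2\<close>, or \<open>j \<ge> 3\<close> in the case \<open>r = 1\<close>; this leaves \<open>k \<le> 4\<close>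
  and \<open>k = 7\<close> to explicit choices.\<close>

lemma heavy_half_splits:
  fixes h k :: nat
  assumes "h \<in> {k, k + 1}" "2 \<le> k" "h + k \<notin> {5, 8, 9}"
  shows "\<exists>Y \<subseteq> {h + 1..h + k}. \<Sum>Y = \<Sum>{1..k}"
proof -
  consider "k = 7" "h = 7" | "k = 7" "h = 8" | "k = 2" "h = 2" | "k = 3" | "k \<ge> 5" "k \<noteq> 7"
    using assms by force
  then show ?thesis
  proof cases
    case 1
    then show ?thesis by (intro exI[of _ "{8, 9, 11}"]) (simp add: Sum_Icc_nat)
  next
    case 2
    then show ?thesis by (intro exI[of _ "{13, 15}"]) (simp add: Sum_Icc_nat)
  next
    case 3
    then show ?thesis by (intro exI[of _ "{3}"]) (simp add: Sum_Icc_nat)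
  next
    case 4
    then show ?thesis using assms(1) by (intro exI[of _ "{6}"]) (auto simp: Sum_Icc_nat)
  next
    case 5
    define j where "j = (k + 1) div 3"
    have j: "2 \<le> j" using 5 by (simp add: j_def)
    have r: "k + 1 = 3 * j \<or> k = 3 * j \<or> k = 3 * j + 1 \<and> 3 \<le> j"
      using 5 unfolding j_def by presburger
    obtain i where i: "j = i + 2" using j by (metis add.commute le_Suc_ex)
    have "2 * (j * h) + j * (j + 1) \<le> k * (k + 1) \<and>
          k * (k + 1) \<le> 2 * (j * (h + k - j)) + j * (j + 1)"
      using r
    proof (elim disjE conjE)
      assume "k + 1 = 3 * j"
      then have k: "k = 3 * i + 5" using i by simp
      have d: "h + k - j = (h - k) + (5 * i + 8)" using assms(1) i k by auto
      show ?thesis using assms(1) unfolding d unfolding i k by (auto simp: algebra_simps)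
    next
      assume "k = 3 * j"
      then have k: "k = 3 * i + 6" using i by simp
      have d: "h + k - j = (h - k) + (5 * i + 10)" using assms(1) i k by auto
      show ?thesis using assms(1) unfolding d unfolding i k by (auto simp: algebra_simps)
    next
      assume "k = 3 * j + 1" "3 \<le> j"
      then obtain l where l: "j = l + 3" "k = 3 * l + 10"
        using that[of "j - 3"] by simp
      have d: "h + k - j = (h - k) + (5 * l + 17)" using assms(1) l by auto
      show ?thesis using assms(1) unfolding d unfolding l by (auto simp: algebra_simps)
    qed
    then have "j * h + \<Sum>{1..j} \<le> \<Sum>{1..k}" "\<Sum>{1..k} \<le> j * (h + k - j) + \<Sum>{1..j}"
      using twice_triangular[of j] twice_triangular[of k] by linarith+
    moreover have "h + k - j + j = h + k" using r by auto
    ultimately show ?thesis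
      using subset_sum_interval[of j h "\<Sum>{1..k}" "h + k - j"] j by simp
  qed
qed

section \<open>Two balanced weighings\<close>

lemma split_determines_coin:
  fixes h k :: nat
  assumes hk: "h \<in> {k, k + 1}" and "1 \<le> k"
    and Y: "Y \<subseteq> {h + 1..h + k}" "\<Sum>Y = \<Sum>{1..k}"
  defines "X \<equiv> {h + 1..h + k} - Y"
  shows "demonstrates_some_coin (h + k) [({1..k}, Y), ({1..h - 1} \<union> Y, X)]"
    (is "demonstrates_some_coin ?n ?Ws")
proof -
  obtain a where a: "h = a + 1" using assms(1,2) by (cases h) auto
  have fin: "finite X" "finite Y" using finite_subset[OF Y(1)] by (auto simp: X_def)
  have total: "sum w {1..?n} = sum w {1..h} + sum w X + sum w Y" for w :: "nat \<Rightarrow> nat"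
  proof -
    have "{1..?n} = {1..h} \<union> (X \<union> Y)" using Y(1) by (auto simp: X_def)
    also have "sum w \<dots> = sum w {1..h} + sum w (X \<union> Y)"
      using fin Y(1) by (intro sum.union_disjoint) (auto simp: X_def)
    also have "sum w (X \<union> Y) = sum w X + sum w Y"
      using fin by (intro sum.union_disjoint) (auto simp: X_def)
    finally show ?thesis by simp
  qed
  have left: "sum w ({1..a} \<union> Y) = sum w {1..a} + sum w Y" for w :: "nat \<Rightarrow> nat"
    using fin Y(1) a by (intro sum.union_disjoint) auto
  have identity: "\<Sum>{1..?n} = \<Sum>{1..h} + \<Sum>{1..a} + 2 * \<Sum>{1..k}"
  proof -
    have "?n * (?n + 1) = h * (h + 1) + a * (a + 1) + 2 * (k * (k + 1))"
      using hk a by (auto simp: algebra_simps)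
    then show ?thesis
      using twice_triangular[of ?n] twice_triangular[of h] twice_triangular[of a]
        twice_triangular[of k] by linarith
  qed
  have balance2: "\<Sum>({1..a} \<union> Y) = \<Sum>X"
    using total[of "\<lambda>x. x"] left[of "\<lambda>x. x"] identity Y(2) by linarith
  have "determines ?n ?Ws h"
    unfolding determines_def
  proof (intro allI impI)
    fix \<sigma> assume "\<sigma> permutes {1..?n} \<and> consistent ?Ws \<sigma>"
    then have \<sigma>: "\<sigma> permutes {1..?n}"
      and out: "outcome \<sigma> ({1..k}, Y) = outcome id ({1..k}, Y)"
        "outcome \<sigma> ({1..a} \<union> Y, X) = outcome id ({1..a} \<union> Y, X)"
      using a by (auto simp: consistent_def)
    have "sum \<sigma> {1..k} = sum \<sigma> Y"
      using balance_preserved[OF out(1)] Y(2) by simp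
    moreover have "sum \<sigma> {1..a} + sum \<sigma> Y = sum \<sigma> X"
      using balance_preserved[OF out(2) balance2] left by simp
    ultimately have "sum \<sigma> {1..h} + sum \<sigma> {1..a} + 2 * sum \<sigma> {1..k} = \<Sum>{1..?n}"
      using total[of \<sigma>] permuted_total_weight[OF \<sigma>] by linarith
    \<comment> \<open>All three sums attain their lower bounds, and coin \<open>h\<close> makes up the difference between
      the first two.\<close>
    then have "sum \<sigma> {1..h} = \<Sum>{1..h}" "sum \<sigma> {1..a} = \<Sum>{1..a}"
      using identity initial_segment_weight_ge[OF \<sigma>, of h] initial_segment_weight_ge[OF \<sigma>, of a]
        initial_segment_weight_ge[OF \<sigma>, of k] a by linarith+
    then show "\<sigma> h = h" using a by simp
  qed
  moreover have "is_weighing ?n ({1..k}, Y)" "is_weighing ?n ({1..a} \<union> Y, X)"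
  proof -
    have "1 \<le> \<Sum>{1..k}" using twice_triangular[of k] \<open>1 \<le> k\<close> by (cases "\<Sum>{1..k}") auto
    then have "Y \<noteq> {}" "X \<noteq> {}"
      using Y(2) balance2 left[of "\<lambda>x. x"] by (auto simp del: sum_eq_0_iff)
    then show "is_weighing ?n ({1..k}, Y)" "is_weighing ?n ({1..a} \<union> Y, X)"
      using Y(1) hk a \<open>1 \<le> k\<close> by (auto simp: is_weighing_def X_def)
  qed
  ultimately show ?thesis
    using a by (auto simp: demonstrates_some_coin_def)
qed

theorem two_weighings_suffice:
  assumes "n \<ge> 1"
  shows "\<exists>Ws. length Ws \<le> 2 \<and> demonstrates_some_coin n Ws"
proof (cases "n \<in> {1, 2, 3, 5, 8, 9}")
  case True
  then show ?thesis by (rule few_coins)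
next
  case False
  define k where "k = n div 2"
  define h where "h = n - k"
  have "4 \<le> n" using False assms by auto
  have n: "n = h + k" and hk: "h \<in> {k, k + 1}" by (auto simp: h_def k_def)
  have k: "2 \<le> k" using \<open>4 \<le> n\<close> by (simp add: k_def)
  obtain Y where Y: "Y \<subseteq> {h + 1..h + k}" "\<Sum>Y = \<Sum>{1..k}"
    using heavy_half_splits[OF hk k] False n by auto
  let ?Ws = "[({1..k}, Y), ({1..h - 1} \<union> Y, {h + 1..h + k} - Y)]"
  have "demonstrates_some_coin n ?Ws"
    unfolding n using k by (intro split_determines_coin[OF hk _ Y]) simp
  then show ?thesis by (intro exI[of _ ?Ws]) simp
qed

theorem theorem3p1:
  fixes n :: nat
  assumes "n \<ge> 1"
  shows "baron n \<le> 3 \<and> (\<exists>Ws. length Ws \<le> 3 \<and> demonstrates_some_coin n Ws)"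
proof -
  obtain Ws where Ws: "length Ws \<le> 2" "demonstrates_some_coin n Ws"
    using two_weighings_suffice[OF assms] by blast
  then have "baron n \<le> length Ws"
    unfolding baron_def by (intro Least_le) blast
  then show ?thesis using Ws by (intro conjI exI[of _ Ws]) auto
qed

end
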